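(* For each positive integer $n$, let $M(n)$ denote the maximum, over all simple undirected connected graphs $G$ of order $n$, of the number of minimal connected dominating sets of $G$. Then $M(n) \in \Omega(1.489^n)$; that is, there exist a real constant $c>0$ and an integer $n_0$ such that $M(n) \ge c\cdot 1.489^n$ for all $n \ge n_0$.
   Context: Graphs are finite, simple and undirected; the order of a graph is its number of vertices. A connected dominating set in a graph $G=(V,E)$ is a set $S\subseteq V$ whose closed neighborhood is $V$ (every vertex of $G$ is in $S$ or adjacent to a vertex of $S$) and such that the subgraph of $G$ induced by $S$ is connected. A connected dominating set is minimal (inclusion minimal) if it does not contain another connected dominating set as a proper subset. *)

theory Defs
  imports "Graph_Theory.Graph_Theory" "HOL-Library.Landau_Symbols"
begin

text \<open>
  A finite simple undirected graph is a \<^locale>\<open>pair_graph\<close>: a finite, loop-free, symmetric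
  digraph whose arcs are ordered pairs of vertices, so that the edge \<open>uv\<close> is represented by the
  two arcs \<open>(u, v)\<close> and \<open>(v, u)\<close>.
\<close>

definition dominating_set :: "'a pair_pre_digraph \<Rightarrow> 'a set \<Rightarrow> bool" where
  "dominating_set G S \<longleftrightarrow> S \<subseteq> pverts G \<and>
     (\<forall>v \<in> pverts G. v \<in> S \<or> (\<exists>u \<in> S. (u, v) \<in> parcs G))"

text \<open>
  \<open>connected\<close> also names the topological notion, hence the qualified name. The graph-theoretic
  one requires a vertex; the empty set dominates only the graph without vertices.
\<close>

definition connected_dominating_set :: "'a pair_pre_digraph \<Rightarrow> 'a set \<Rightarrow> bool" where
  "connected_dominating_set G S \<longleftrightarrow> dominating_set G S \<and> 
     Digraph_Component.connected (with_proj G \<restriction> S)"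

definition minimal_connected_dominating_set :: "'a pair_pre_digraph \<Rightarrow> 'a set \<Rightarrow> bool" where
  "minimal_connected_dominating_set G S \<longleftrightarrow> connected_dominating_set G S \<and>
     \<not> (\<exists>T. T \<subset> S \<and> connected_dominating_set G T)"

definition num_minimal_cds :: "'a pair_pre_digraph \<Rightarrow> nat" where
  "num_minimal_cds G = card {S. minimal_connected_dominating_set G S}"

text \<open>
  Every finite graph is isomorphic to one whose vertices are natural numbers, so it suffices to
  let the vertex sets range over the sets of \<open>n\<close> natural numbers. There are infinitely many such
  graphs, but for \<open>n > 0\<close> the set of their counts is finite and nonempty, as shown below.
\<close>

definition minimal_cds_counts :: "nat \<Rightarrow> nat set" where
  "minimal_cds_counts n = {num_minimal_cds G | G :: nat pair_pre_digraph.
     pair_graph G \<and> Digraph_Component.connected (with_proj G) \<and> card (pverts G) = n}"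

definition max_minimal_cds :: "nat \<Rightarrow> nat" where
  "max_minimal_cds n = Max (minimal_cds_counts n)"

lemma num_minimal_cds_le:
  assumes "finite (pverts G)"
  shows "num_minimal_cds G \<le> 2 ^ card (pverts G)"
proof -
  have "{S. minimal_connected_dominating_set G S} \<subseteq> Pow (pverts G)"
    by (auto simp: minimal_connected_dominating_set_def connected_dominating_set_def
        dominating_set_def)
  with assms have "card {S. minimal_connected_dominating_set G S} \<le> card (Pow (pverts G))"
    by (intro card_mono) auto
  with assms show ?thesis
    by (simp add: num_minimal_cds_def card_Pow)
qed

lemma finite_minimal_cds_counts: "finite (minimal_cds_counts n)"
proof (rule finite_subset)
  show "minimal_cds_counts n \<subseteq> {..2 ^ n}"
    by (auto simp: minimal_cds_counts_def pair_graph_def pair_digraph_def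
        dest!: pair_fin_digraph.pair_finite_verts num_minimal_cds_le)
qed simp

lemma minimal_cds_counts_nonempty:
  assumes "n > 0"
  shows "minimal_cds_counts n \<noteq> {}"
proof -
  define G where "G = \<lparr>pverts = {..<n}, parcs = {(u, v). u < n \<and> v < n \<and> u \<noteq> v}\<rparr>"
  have "finite {(u, v). u < n \<and> v < n \<and> u \<noteq> v}"
    by (rule finite_subset[of _ "{..<n} \<times> {..<n}"]) auto
  then interpret pair_graph G
    by unfold_locales (auto simp: G_def symmetric_def sym_def)
  have "u \<rightarrow>\<^sup>*\<^bsub>with_proj G\<^esub> v" if "u < n" "v < n" for u v
  proof (cases "u = v")
    case True
    with that show ?thesis using reachable_refl[of v] by (simp add: G_def)
  next
    case False
    with that have "(u, v) \<in> parcs G" by (simp add: G_def)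
    then show ?thesis by (rule reachable_adjI)
  qed
  then have "u \<rightarrow>\<^sup>*\<^bsub>with_proj (mk_symmetric (with_proj G))\<^esub> v" if "u < n" "v < n" for u v
    using that by (blast intro: reachable_mk_symmetricI)
  with assms have "Digraph_Component.connected (with_proj G)"
    by (auto simp: Digraph_Component.connected_def strongly_connected_def G_def)
  moreover have "card (pverts G) = n" by (simp add: G_def)
  ultimately show ?thesis
    using pair_graph_axioms pair_graph by (auto simp: minimal_cds_counts_def)
qed

end

theory Submission
  imports Defs
begin

text \<open>
  Take \<open>k\<close> disjoint copies of a small gadget graph and a hub that is adjacent to a set \<open>A\<close> of
  vertices in every copy and to at least one leaf. The leaf forces the hub into every connected
  dominating set. Once the hub is in the set the copies no longer interact: in each of them one
  needs a set that dominates the vertices outside \<open>A\<close> and all of whose components meet \<open>A\<close>.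
  Hence the minimal connected dominating sets without leaves correspond to independent choices
  of a minimal such set in every copy. A gadget with \<open>9\<close> vertices that has \<open>40\<close> minimal sets gives
  a growth rate of \<open>40\<close> to the power \<open>1/9\<close>, which is about \<open>1.5066\<close>.
\<close>

section \<open>Connected dominating sets in symmetric graphs\<close>

text \<open>Symmetrising a symmetric arc set changes nothing, and \<open>rtrancl_on S\<close>
  already confines walks to \<open>S\<close>, so restricting the arcs to \<open>S\<close> has no
  further effect.\<close>

lemma connected_induce_iff:
  assumes "sym (parcs G)"
  shows "Digraph_Component.connected (with_proj G \<restriction> S) \<longleftrightarrow>
    S \<noteq> {} \<and> (\<forall>u\<in>S. \<forall>v\<in>S. (u, v) \<in> rtrancl_on S (parcs G))"
proof -
  let ?H = "mk_symmetric (with_proj G \<restriction> S)"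
  have arcs: "parcs ?H = parcs G \<inter> S \<times> S"
    using symD[OF assms] by (auto simp: mk_symmetric_def)
  have "rtrancl_on S (parcs G \<inter> S \<times> S) = rtrancl_on S (parcs G)"
  proof (intro equalityI subrelI)
    fix u v assume "(u, v) \<in> rtrancl_on S (parcs G)"
    then show "(u, v) \<in> rtrancl_on S (parcs G \<inter> S \<times> S)"
      by (induction rule: rtrancl_on_induct) (auto intro: rtrancl_on_into_rtrancl_on)
  qed (auto intro: rtrancl_on_mono[of "parcs G \<inter> S \<times> S" "parcs G" S S])
  then show ?thesis
    unfolding Digraph_Component.connected_def strongly_connected_def reachable_def
    by (simp add: arcs)
qed

text \<open>From a fixed vertex of \<open>S\<close>, every vertex is reached by a walk inside
  \<open>S\<close> followed by at most one arc. This later yields connectedness of the hub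
  graph.\<close>

lemma connected_if_connected_dominating_set:
  assumes "sym (parcs G)" "parcs G \<subseteq> pverts G \<times> pverts G" "connected_dominating_set G S"
  shows "Digraph_Component.connected (with_proj G)"
proof -
  let ?V = "pverts G" and ?E = "parcs G"
  have S: "S \<subseteq> ?V" "S \<noteq> {}" and dom: "\<And>v. v \<in> ?V \<Longrightarrow> v \<in> S \<or> (\<exists>u\<in>S. (u, v) \<in> ?E)"
    and conn: "\<And>u v. u \<in> S \<Longrightarrow> v \<in> S \<Longrightarrow> (u, v) \<in> rtrancl_on S ?E"
    using assms(3) connected_induce_iff[OF assms(1)]
    by (auto simp: connected_dominating_set_def dominating_set_def)
  obtain x where x: "x \<in> S" using S by auto
  have from_x: "(x, v) \<in> rtrancl_on ?V ?E" if v: "v \<in> ?V" for v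
  proof -
    have S_case: "(x, u) \<in> rtrancl_on ?V ?E" if "u \<in> S" for u
      using conn[OF x that] S(1) by (auto intro: rtrancl_on_mono[of ?E ?E S])
    from dom[OF v] show ?thesis
      using S_case v by (auto intro: rtrancl_on_into_rtrancl_on)
  qed
  have "(u, v) \<in> rtrancl_on ?V ?E" if "u \<in> ?V" "v \<in> ?V" for u v
    using rtrancl_on_trans[OF symD[OF rtrancl_on_sym[OF assms(1)] from_x[OF that(1)]] from_x[OF that(2)]] .
  moreover have "parcs (mk_symmetric (with_proj G)) = ?E"
    using symD[OF assms(1)] by (auto simp: mk_symmetric_def)
  ultimately show ?thesis
    using S unfolding Digraph_Component.connected_def strongly_connected_def reachable_def
    by auto
qed

section \<open>Gadgets glued to a hub\<close>

text \<open>
  The copy \<open>i < k\<close> of the vertex \<open>j < m\<close> of the gadget is encoded as \<open>m * i + j\<close>, the hub is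
  \<open>m * k\<close>, and the vertices from \<open>m * k + 1\<close> to \<open>n - 1\<close> are leaves.
\<close>

locale gadget =
  fixes m :: nat and R :: "nat rel" and A :: "nat set"
  assumes R_subset: "R \<subseteq> {..<m} \<times> {..<m}"
    and sym_R: "sym R"
    and irrefl_R: "irrefl R"
begin

definition admissible :: "nat set \<Rightarrow> bool" where
  "admissible T \<longleftrightarrow> T \<subseteq> {..<m} \<and> (\<forall>v<m. v \<in> A \<or> v \<in> T \<or> (\<exists>u\<in>T. (u, v) \<in> R)) \<and>
     (\<forall>v\<in>T. \<exists>u\<in>T \<inter> A. (u, v) \<in> rtrancl_on T R)"

definition minimal_admissible :: "nat set \<Rightarrow> bool" where
  "minimal_admissible T \<longleftrightarrow> admissible T \<and> \<not> (\<exists>T'. T' \<subset> T \<and> admissible T')"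

text \<open>Hub edges are listed only in the direction away from the hub; \<open>hub_graph\<close>
  adds the reversed arcs.\<close>

definition link :: "nat \<Rightarrow> nat \<Rightarrow> nat \<Rightarrow> bool" where
  "link k u v \<longleftrightarrow>
     v < m * k \<and> (u < m * k \<and> u div m = v div m \<and> (u mod m, v mod m) \<in> R \<or>
       u = m * k \<and> v mod m \<in> A) \<or>
     u = m * k \<and> m * k < v"

definition hub_graph :: "nat \<Rightarrow> nat \<Rightarrow> nat pair_pre_digraph" where
  "hub_graph k n = \<lparr>pverts = {..<n}, parcs = {(u, v). u < n \<and> v < n \<and> (link k u v \<or> link k v u)}\<rparr>"

definition slice :: "nat \<Rightarrow> nat set \<Rightarrow> nat set" where
  "slice i S = {j. j < m \<and> m * i + j \<in> S}"

definition glue :: "nat \<Rightarrow> (nat \<Rightarrow> nat set) \<Rightarrow> nat set" where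
  "glue k f = insert (m * k) {v. v < m * k \<and> v mod m \<in> f (v div m)}"

section \<open>Arithmetic of the encoding; slices and gluing\<close>

lemma copy_less:
  assumes "i < k" "j < m"
  shows "m * i + j < m * k"
proof -
  have "m * i + j < m * Suc i" using assms by simp
  also have "\<dots> \<le> m * k" using assms by (intro mult_le_mono2) simp
  finally show ?thesis .
qed

lemma div_less_copies: "v < m * k \<Longrightarrow> v div m < k"
  by (simp add: less_mult_imp_div_less mult.commute)

lemma mod_less_size: "v < m * k \<Longrightarrow> v mod m < m"
  by (cases m) auto

lemma mem_slice_iff: "v < m * k \<Longrightarrow> v mod m \<in> slice (v div m) S \<longleftrightarrow> v \<in> S"
  by (simp add: slice_def mod_less_size)

lemma slice_glue:
  assumes "i < k" "f i \<subseteq> {..<m}"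
  shows "slice i (glue k f) = f i"
proof -
  have "m * i + j < m * k" "m * i + j \<noteq> m * k" if "j < m" for j
    using copy_less[OF assms(1) that] by auto
  then show ?thesis
    using assms by (auto simp: slice_def glue_def)
qed

section \<open>Arcs of the hub graph\<close>

lemma hub_graph_simps [simp]:
  "pverts (hub_graph k n) = {..<n}"
  "(u, v) \<in> parcs (hub_graph k n) \<longleftrightarrow> u < n \<and> v < n \<and> (link k u v \<or> link k v u)"
  by (auto simp: hub_graph_def)

lemma sym_hub_graph: "sym (parcs (hub_graph k n))"
  by (auto intro: symI)

lemma arcs_hub_graph: "parcs (hub_graph k n) \<subseteq> {..<n} \<times> {..<n}"
  by auto

lemma arc_to_copy_iff:
  assumes "v < m * k" "m * k < n"
  shows "(u, v) \<in> parcs (hub_graph k n) \<longleftrightarrow>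
    u < m * k \<and> u div m = v div m \<and> (u mod m, v mod m) \<in> R \<or> u = m * k \<and> v mod m \<in> A"
  using assms symD[OF sym_R] by (auto simp: link_def)

lemma pair_graph_hub_graph: "pair_graph (hub_graph k n)"
proof -
  have "finite (parcs (hub_graph k n))"
    using finite_subset[OF arcs_hub_graph] by blast
  then show ?thesis
    using irrefl_R sym_hub_graph
    by unfold_locales
      (auto simp: hub_graph_def symmetric_def link_def irrefl_def)
qed

section \<open>Connected dominating sets and admissible slices\<close>

text \<open>A vertex of a copy has neighbours only in its own copy and possibly the hub. Hence only
  the hub can dominate it from outside, and a walk from the hub to it ends with a stretch inside the
  copy that starts in \<open>A\<close>.\<close>

lemma admissible_slice_if_connected_dominating_set:
  assumes "m * k < n" "S \<subseteq> {..m * k}" "m * k \<in> S"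
    and cds: "connected_dominating_set (hub_graph k n) S" and i: "i < k"
  shows "admissible (slice i S)"
proof -
  let ?E = "parcs (hub_graph k n)"
  have dom: "\<And>v. v < n \<Longrightarrow> v \<in> S \<or> (\<exists>u\<in>S. (u, v) \<in> ?E)"
    and conn: "\<And>u v. u \<in> S \<Longrightarrow> v \<in> S \<Longrightarrow> (u, v) \<in> rtrancl_on S ?E"
    using cds connected_induce_iff[OF sym_hub_graph]
    by (auto simp: connected_dominating_set_def dominating_set_def)
  have "j \<in> A \<or> j \<in> slice i S \<or> (\<exists>u\<in>slice i S. (u, j) \<in> R)" if j: "j < m" for j
  proof -
    have less: "m * i + j < m * k" using copy_less[OF i j] .
    consider "m * i + j \<in> S" | u where "u \<in> S" "(u, m * i + j) \<in> ?E"
      using dom[of "m * i + j"] less assms(1) by auto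
    then show ?thesis
    proof cases
      case 1
      then show ?thesis using j by (simp add: slice_def)
    next
      case (2 u)
      then consider "j \<in> A" | "u < m * k" "u div m = i" "(u mod m, j) \<in> R"
        using less assms(1) j by (auto simp only: arc_to_copy_iff) auto
      then show ?thesis
        by cases (use 2 mem_slice_iff in blast)+
    qed
  qed
  \<comment> \<open>Induction along a walk from the hub: an arc inside a copy prolongs the anchored
    walk, an arc from the hub lands in \<open>A\<close> and starts a new one. The copy is that of
    \<open>w\<close>, not a fixed one, because the walk may visit several copies.\<close>
  moreover have anchored: "\<exists>u\<in>slice (w div m) S \<inter> A. (u, w mod m) \<in> rtrancl_on (slice (w div m) S) R"
    if "(m * k, w) \<in> rtrancl_on S ?E" "w < m * k" for w
    using that
  proof (induction rule: rtrancl_on_induct)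
    case (step y z)
    have z: "z mod m \<in> slice (z div m) S"
      using step by (simp add: mem_slice_iff)
    from step.hyps(2) step.prems assms(1)
    consider "y < m * k" "y div m = z div m" "(y mod m, z mod m) \<in> R" | "z mod m \<in> A"
      by (auto simp only: arc_to_copy_iff)
    then show ?case
    proof cases
      case 1
      then show ?thesis using step.IH z by (auto intro: rtrancl_on_into_rtrancl_on)
    next
      case 2
      then show ?thesis using z by auto
    qed
  qed simp
  have "\<exists>u\<in>slice i S \<inter> A. (u, j) \<in> rtrancl_on (slice i S) R" if "j \<in> slice i S" for j
  proof -
    have j: "j < m" "m * i + j \<in> S" using that by (auto simp: slice_def)
    then show ?thesis
      using anchored[OF conn[OF assms(3) j(2)] copy_less[OF i j(1)]] by simp
  qed
  ultimately show ?thesis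
    by (auto simp: admissible_def slice_def)
qed

text \<open>Each chosen vertex of a copy is joined to a chosen vertex of \<open>A\<close>, which is
  adjacent to the hub. The hub also dominates the leaves and the copies of \<open>A\<close>.\<close>

lemma connected_dominating_set_if_admissible_slices:
  assumes "m * k < n" "S \<subseteq> {..m * k}" "m * k \<in> S"
    and adm: "\<And>i. i < k \<Longrightarrow> admissible (slice i S)"
  shows "connected_dominating_set (hub_graph k n) S"
proof -
  let ?E = "parcs (hub_graph k n)"
  have from_hub: "(m * k, w) \<in> rtrancl_on S ?E" if w: "w \<in> S" for w
  proof (cases "w = m * k")
    case True
    then show ?thesis using assms(3) by simp
  next
    case False
    then have less: "w < m * k" using w assms(2) by force
    let ?i = "w div m"
    let ?T = "slice ?i S"
    have i: "?i < k" using div_less_copies[OF less] .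
    have in_S: "m * ?i + j \<in> S" "m * ?i + j < m * k" "j < m" if "j \<in> ?T" for j
      using that copy_less[OF i] by (auto simp: slice_def)
    obtain u where u: "u \<in> ?T" "u \<in> A" "(u, w mod m) \<in> rtrancl_on ?T R"
      using adm[OF i] less w mem_slice_iff[OF less] unfolding admissible_def by blast
    \<comment> \<open>A walk in the gadget is lifted to the copy, with the arc from the hub to
      \<open>u\<close> put in front.\<close>
    from u(3) have "(m * k, m * ?i + w mod m) \<in> rtrancl_on S ?E"
    proof (induction rule: rtrancl_on_induct)
      case base
      have "(m * k, m * ?i + u) \<in> ?E"
        using in_S[OF u(1)] assms(1) u(2) by (simp only: arc_to_copy_iff) simp
      then show ?case
        using assms(3) in_S[OF u(1)] by (auto intro: rtrancl_on_into_rtrancl_on)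
    next
      case (step y z)
      have "(m * ?i + y, m * ?i + z) \<in> ?E"
        using in_S[OF step.hyps(3)] in_S[OF step.hyps(4)] assms(1) step.hyps(2)
        by (simp only: arc_to_copy_iff) simp
      then show ?case
        using step.IH in_S[OF step.hyps(4)] by (auto intro: rtrancl_on_into_rtrancl_on)
    qed
    then show ?thesis by simp
  qed
  have "(u, v) \<in> rtrancl_on S ?E" if "u \<in> S" "v \<in> S" for u v
    using rtrancl_on_trans[OF symD[OF rtrancl_on_sym[OF sym_hub_graph] from_hub[OF that(1)]]
        from_hub[OF that(2)]] .
  then have "Digraph_Component.connected (with_proj (hub_graph k n) \<restriction> S)"
    using connected_induce_iff[OF sym_hub_graph] assms(3) by blast
  moreover have "v \<in> S \<or> (\<exists>u\<in>S. (u, v) \<in> ?E)" if v: "v < n" for v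
  proof -
    consider "v < m * k" | "v = m * k" | "m * k < v" by linarith
    then show ?thesis
    proof cases
      case 1
      let ?i = "v div m"
      have i: "?i < k" using div_less_copies[OF 1] .
      consider "v mod m \<in> A" | "v mod m \<in> slice ?i S"
        | u where "u \<in> slice ?i S" "(u, v mod m) \<in> R"
        using adm[OF i] mod_less_size[OF 1] unfolding admissible_def by blast
      then show ?thesis
      proof cases
        assume "v mod m \<in> A"
        then show ?thesis using assms(1,3) 1 arc_to_copy_iff by blast
      next
        assume "v mod m \<in> slice ?i S"
        then show ?thesis using mem_slice_iff[OF 1] by blast
      next
        fix u assume u: "u \<in> slice ?i S" "(u, v mod m) \<in> R"
        then have "m * ?i + u \<in> S" "u < m" by (auto simp: slice_def)
        moreover have "(m * ?i + u, v) \<in> ?E"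
          using 1 assms(1) copy_less[OF i \<open>u < m\<close>] u \<open>u < m\<close>
          by (simp only: arc_to_copy_iff) simp
        ultimately show ?thesis by blast
      qed
    next
      case 2
      then show ?thesis using assms(3) by simp
    next
      case 3
      then have "(m * k, v) \<in> ?E" using v by (auto simp: link_def)
      then show ?thesis using assms(3) by blast
    qed
  qed
  ultimately show ?thesis
    using assms(1,2) by (force simp: connected_dominating_set_def dominating_set_def)
qed

text \<open>The leaf \<open>m * k + 1\<close> lies outside \<open>S\<close>, and its only neighbour
  is the hub.\<close>

lemma hub_mem_dominating_set:
  assumes "m * k + 1 < n" "S \<subseteq> {..m * k}" "dominating_set (hub_graph k n) S"
  shows "m * k \<in> S"
proof -
  have "m * k + 1 \<in> {..<n}" "m * k + 1 \<notin> S" using assms by auto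
  then obtain u where "u \<in> S" "(u, m * k + 1) \<in> parcs (hub_graph k n)"
    using assms(3) unfolding dominating_set_def by auto
  then show ?thesis by (auto simp: link_def)
qed

section \<open>Minimal sets and their number\<close>

text \<open>A connected dominating subset still contains the hub, and its slices are admissible
  subsets of the minimal sets \<open>f i\<close>. So all slices agree with \<open>f\<close>, and
  nothing was removed.\<close>

lemma minimal_glue:
  assumes n: "m * k + 1 < n" and f: "\<And>i. i < k \<Longrightarrow> minimal_admissible (f i)"
  shows "minimal_connected_dominating_set (hub_graph k n) (glue k f)"
proof -
  have sub: "f i \<subseteq> {..<m}" if "i < k" for i
    using f[OF that] by (auto simp: minimal_admissible_def admissible_def)
  have glue: "glue k f \<subseteq> {..m * k}" "m * k \<in> glue k f" by (auto simp: glue_def)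
  have "connected_dominating_set (hub_graph k n) (glue k f)"
    using n glue f by (intro connected_dominating_set_if_admissible_slices)
      (auto simp: slice_glue sub minimal_admissible_def)
  moreover have False
    if T: "T \<subset> glue k f" and cds: "connected_dominating_set (hub_graph k n) T" for T
  proof -
    have T_sub: "T \<subseteq> {..m * k}" using T glue by auto
    have hub: "m * k \<in> T"
      using hub_mem_dominating_set[OF n T_sub] cds by (simp add: connected_dominating_set_def)
    have slice: "slice i T = f i" if i: "i < k" for i
    proof -
      have "admissible (slice i T)"
        using n T_sub hub cds i by (intro admissible_slice_if_connected_dominating_set) auto
      moreover have "slice i T \<subseteq> f i"
        using slice_glue[of i k f] i sub[OF i] T by (auto simp: slice_def)
      ultimately show ?thesis
        using f[OF i] by (auto simp: minimal_admissible_def)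
    qed
    have "v \<in> T" if "v \<in> glue k f" for v
      using that hub slice[OF div_less_copies] mem_slice_iff[of v k T] by (auto simp: glue_def)
    then show False using T by auto
  qed
  ultimately show ?thesis
    by (auto simp: minimal_connected_dominating_set_def)
qed

text \<open>The slices of \<open>glue k f\<close> recover \<open>f\<close>, so different choices
  give different minimal sets.\<close>

lemma max_minimal_cds_ge:
  assumes n: "m * k + 1 < n" and ex: "minimal_admissible T"
  shows "card {T. minimal_admissible T} ^ k \<le> max_minimal_cds n"
proof -
  let ?G = "hub_graph k n" and ?M = "{T. minimal_admissible T}"
  let ?F = "PiE {..<k} (\<lambda>_. ?M)"
  have "inj_on (glue k) ?F"
  proof (rule inj_onI)
    fix f g assume fg: "f \<in> ?F" "g \<in> ?F" "glue k f = glue k g"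
    have "f i = g i" if "i < k" for i
    proof -
      have "f i \<subseteq> {..<m}" "g i \<subseteq> {..<m}"
        using fg(1,2) that by (auto simp: PiE_iff minimal_admissible_def admissible_def)
      then show ?thesis using slice_glue[OF that] fg(3) by metis
    qed
    then show "f = g" using fg(1,2) by (intro PiE_ext) auto
  qed
  then have "card ?M ^ k = card (glue k ` ?F)"
    by (simp add: card_image card_PiE)
  also have "\<dots> \<le> num_minimal_cds ?G"
    unfolding num_minimal_cds_def
  proof (rule card_mono)
    show "finite {S. minimal_connected_dominating_set ?G S}"
      by (rule finite_subset[of _ "Pow {..<n}"])
        (auto simp: minimal_connected_dominating_set_def connected_dominating_set_def
          dominating_set_def)
    show "glue k ` ?F \<subseteq> {S. minimal_connected_dominating_set ?G S}"
      using minimal_glue[OF n] by (auto simp: PiE_iff)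
  qed
  \<comment> \<open>One connected dominating set suffices to show that the hub graph is connected,
    so that its count enters the maximum.\<close>
  also have "connected_dominating_set ?G (glue k (\<lambda>_. T))"
    using minimal_glue[OF n, of "\<lambda>_. T"] ex by (simp add: minimal_connected_dominating_set_def)
  then have "num_minimal_cds ?G \<in> minimal_cds_counts n"
    using pair_graph_hub_graph connected_if_connected_dominating_set[OF sym_hub_graph] arcs_hub_graph
    by (auto simp: minimal_cds_counts_def intro!: exI[of _ ?G])
  then have "num_minimal_cds ?G \<le> max_minimal_cds n"
    using finite_minimal_cds_counts by (simp add: max_minimal_cds_def)
  finally show ?thesis .
qed

end

section \<open>A gadget with nine vertices\<close>

text \<open>
  The gadget was found by a computer search over graphs with a symmetry of order three: for
  \<open>i\<close> modulo \<open>3\<close>, the vertex \<open>i\<close> is adjacent to \<open>3 + i\<close>, \<open>3 + (i - 1)\<close> and \<open>6 + i\<close>, the vertex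
  \<open>3 + i\<close> is adjacent to \<open>6 + i\<close> and \<open>6 + (i + 1)\<close>, and \<open>{3, 4, 5}\<close> and \<open>{6, 7, 8}\<close> are triangles.
  No admissible set has fewer than three elements, so all \<open>40\<close> admissible triples are minimal.
\<close>

definition nbrs :: "nat \<Rightarrow> nat list" where
  "nbrs v = [[3, 5, 6], [3, 4, 7], [4, 5, 8], [0, 1, 4, 5, 6, 7], [1, 2, 3, 5, 7, 8],
     [0, 2, 3, 4, 6, 8], [0, 3, 5, 7, 8], [1, 3, 4, 6, 8], [2, 4, 5, 6, 7]] ! v"

definition nine_edges :: "nat rel" where
  "nine_edges = {(u, v). u < 9 \<and> v \<in> set (nbrs u)}"

lemma nbrs_sym: "\<forall>u\<in>set [0..<9]. \<forall>v\<in>set (nbrs u). v < 9 \<and> u \<noteq> v \<and> u \<in> set (nbrs v)"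
  by code_simp

lemma nbrsD:
  assumes "u < 9" "v \<in> set (nbrs u)"
  shows "v < 9" "u \<noteq> v" "u \<in> set (nbrs v)"
proof -
  have "u \<in> set [0..<9]" using assms(1) by (simp only: set_upt atLeastLessThan_iff zero_le)
  from bspec[OF bspec[OF nbrs_sym this] assms(2)]
  show "v < 9" "u \<noteq> v" "u \<in> set (nbrs v)" by blast+
qed

interpretation nine: gadget 9 nine_edges "{..<3}"
proof
  show "nine_edges \<subseteq> {..<9} \<times> {..<9}" "sym nine_edges" "irrefl nine_edges"
    by (auto simp: nine_edges_def sym_def irrefl_def dest: nbrsD)
qed

text \<open>Executable form of the domination clause of \<open>nine.admissible\<close>. The range
  starts at \<open>3\<close> because the vertices below \<open>3\<close> are those of
  \<open>A\<close>.\<close>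

definition dominates_rest :: "nat list \<Rightarrow> bool" where
  "dominates_rest xs \<longleftrightarrow> (\<forall>v\<in>set [3..<9]. v \<in> set xs \<or> (\<exists>u\<in>set (nbrs v). u \<in> set xs))"

text \<open>In a set of three vertices a path has at most two arcs, so looking two arcs away for a
  vertex of \<open>A\<close> is enough.\<close>

definition anchored_triple :: "nat list \<Rightarrow> bool" where
  "anchored_triple xs \<longleftrightarrow> length xs = 3 \<and> dominates_rest xs \<and>
     (\<forall>v\<in>set xs. v < 3 \<or> (\<exists>u\<in>set (nbrs v). u \<in> set xs \<and>
        (u < 3 \<or> (\<exists>w\<in>set (nbrs u). w \<in> set xs \<and> w < 3))))"

section \<open>Evaluation over all subsets of the gadget\<close>

lemma card_anchored_triples: "length (filter anchored_triple (subseqs [0..<9])) = 40"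
  by code_simp

text \<open>Small dominating sets that meet \<open>A\<close> do exist, such as
  \<open>{0, 4}\<close>; what excludes them is an isolated vertex outside \<open>A\<close>.\<close>

lemma no_small_anchored:
  "\<forall>xs\<in>set (subseqs [0..<9]). length xs < 3 \<and> dominates_rest xs \<and> (\<exists>u\<in>set xs. u < 3) \<longrightarrow>
     (\<exists>v\<in>set xs. \<not> v < 3 \<and> \<not> (\<exists>u\<in>set (nbrs v). u \<in> set xs))"
  by code_simp

lemma set_subseq_less:
  assumes "xs \<in> set (subseqs [0..<n])"
  shows "set xs \<subseteq> {..<n}" "distinct xs"
proof -
  have "set xs \<in> Pow (set [0..<n])"
    using imageI[OF assms, of set] by (simp only: subseqs_powset)
  then show "set xs \<subseteq> {..<n}" by (auto simp: subset_iff)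
  show "distinct xs" using subseqs_distinctD[OF assms] by simp
qed

lemma edge_iff: "v < 9 \<Longrightarrow> (u, v) \<in> nine_edges \<longleftrightarrow> u \<in> set (nbrs v)"
  by (auto simp: nine_edges_def dest: nbrsD)

lemma dominates_rest_iff:
  "dominates_rest xs \<longleftrightarrow> (\<forall>v<9. v \<in> {..<3} \<or> v \<in> set xs \<or> (\<exists>u\<in>set xs. (u, v) \<in> nine_edges))"
proof -
  have "(\<exists>u\<in>set xs. (u, v) \<in> nine_edges) \<longleftrightarrow> (\<exists>u\<in>set (nbrs v). u \<in> set xs)" if "v < 9" for v
    using edge_iff[OF that] by auto
  then show ?thesis
    unfolding dominates_rest_def set_upt by (simp add: Ball_def) (metis not_less)
qed

lemma card_ge_if_admissible:
  assumes "nine.admissible T"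
  shows "3 \<le> card T"
proof (rule ccontr)
  assume less: "\<not> 3 \<le> card T"
  have T: "T \<subseteq> {..<9}" using assms by (simp add: nine.admissible_def)
  then have "T \<in> set ` set (subseqs [0..<9])"
    by (simp add: subseqs_powset atLeast0LessThan)
  then obtain xs where xs: "xs \<in> set (subseqs [0..<9])" and T_eq: "T = set xs" by auto
  have len: "length xs < 3"
    using less set_subseq_less(2)[OF xs] by (simp add: T_eq distinct_card)
  have dom: "dominates_rest xs"
    using assms unfolding nine.admissible_def dominates_rest_iff T_eq by blast
  then have "xs \<noteq> []" by (auto simp: dominates_rest_def)
  then have "\<exists>u\<in>set xs. u < 3"
    using assms unfolding nine.admissible_def T_eq by (metis IntE ex_in_conv lessThan_iff set_empty)
  then obtain v where v: "v \<in> set xs" "\<not> v < 3" "\<not> (\<exists>u\<in>set (nbrs v). u \<in> set xs)"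
    using no_small_anchored xs len dom by blast
  obtain u where u: "u \<in> set xs" "u < 3" "(u, v) \<in> rtrancl_on (set xs) nine_edges"
    using assms v(1) unfolding nine.admissible_def T_eq by auto
  \<comment> \<open>The last arc of the walk from \<open>u\<close> to \<open>v\<close> would give
    the isolated vertex \<open>v\<close> a neighbour in the set.\<close>
  from u(3) show False
  proof (cases rule: rtrancl_on.cases)
    case rtrancl_on_refl
    then show False using u v by simp
  next
    case (rtrancl_on_into_rtrancl_on w)
    have "w \<in> set xs" using in_rtrancl_on_in_F[OF rtrancl_on_into_rtrancl_on(1)] by simp
    moreover have "w \<in> set (nbrs v)"
      using rtrancl_on_into_rtrancl_on edge_iff v(1) T T_eq by auto
    ultimately show False using v(3) by blast
  qed
qed

text \<open>The neighbour tests yield walks with at most two arcs from \<open>A\<close>, which gives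
  admissibility. Minimality is by size: a proper subset has fewer than three elements.\<close>

lemma minimal_admissible_if_anchored_triple:
  assumes xs: "xs \<in> set (subseqs [0..<9])" and triple: "anchored_triple xs"
  shows "nine.minimal_admissible (set xs)"
proof -
  have sub: "set xs \<subseteq> {..<9}" using set_subseq_less(1)[OF xs] .
  have refl: "(v, v) \<in> rtrancl_on (set xs) nine_edges" if "v \<in> set xs" for v
    using that by simp
  have "\<exists>u\<in>set xs \<inter> {..<3}. (u, v) \<in> rtrancl_on (set xs) nine_edges" if v: "v \<in> set xs" for v
  proof -
    have edge: "(u, v) \<in> nine_edges" if "v \<in> set xs" "u \<in> set (nbrs v)" for u v
      using that edge_iff sub by auto
    consider "v < 3"
      | u where "u \<in> set (nbrs v)" "u \<in> set xs" "u < 3"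
      | u w where "u \<in> set (nbrs v)" "u \<in> set xs" "w \<in> set (nbrs u)" "w \<in> set xs" "w < 3"
      using triple v unfolding anchored_triple_def by blast
    then show ?thesis
    proof cases
      case 1
      then show ?thesis using refl[OF v] v by auto
    next
      case (2 u)
      then show ?thesis
        using rtrancl_on_into_rtrancl_on[OF refl edge v] v by blast
    next
      case (3 u w)
      have "(w, v) \<in> rtrancl_on (set xs) nine_edges"
        using rtrancl_on_into_rtrancl_on[OF rtrancl_on_into_rtrancl_on[OF refl edge] edge] 3 v
        by blast
      then show ?thesis using 3 by blast
    qed
  qed
  then have "nine.admissible (set xs)"
    using sub triple unfolding nine.admissible_def anchored_triple_def dominates_rest_iff by blast
  moreover have "\<not> nine.admissible T" if "T \<subset> set xs" for T
    using psubset_card_mono[OF _ that] card_ge_if_admissible[of T] card_length[of xs] triple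
    by (fastforce simp: anchored_triple_def)
  ultimately show ?thesis
    unfolding nine.minimal_admissible_def by blast
qed

text \<open>Distinct sublists of a list without repetitions have distinct sets, so the
  \<open>40\<close> lists found by evaluation are \<open>40\<close> sets.\<close>

lemma card_minimal_admissible: "40 \<le> card {T. nine.minimal_admissible T}"
proof -
  let ?L = "filter anchored_triple (subseqs [0..<9])"
  have "distinct (map set (subseqs [0..<9]))" by (rule distinct_set_subseqs) simp
  then have "distinct (map set ?L)" by (rule distinct_map_filter)
  then have "card (set ` set ?L) = 40"
    using distinct_card[of "map set ?L"] card_anchored_triples by simp
  moreover have "finite {T. nine.minimal_admissible T}"
    by (rule finite_subset[of _ "Pow {..<9}"])
      (auto simp: nine.minimal_admissible_def nine.admissible_def)
  then have "card (set ` set ?L) \<le> card {T. nine.minimal_admissible T}"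
    using minimal_admissible_if_anchored_triple by (intro card_mono) auto
  ultimately show ?thesis by simp
qed

section \<open>The growth rate\<close>

theorem theorem1:
  shows "(\<lambda>n. real (max_minimal_cds n)) \<in> \<Omega>(\<lambda>n. (1.489 :: real) ^ n)"
proof (rule landau_omega.bigI)
  \<comment> \<open>The constant pays for the at most ten vertices outside the copies: the hub and
    one to nine leaves.\<close>
  show "1 / 1.489 ^ 10 > (0 :: real)" by simp
  show "\<forall>\<^sub>F n in at_top. 1 / 1.489 ^ 10 * norm ((1.489 :: real) ^ n) \<le> norm (real (max_minimal_cds n))"
    using eventually_ge_at_top[of 2]
  proof eventually_elim
    case (elim n)
    \<comment> \<open>Two vertices are set aside for the hub and one leaf; the remainder of the
      division becomes further leaves.\<close>
    define k where "k = (n - 2) div 9"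
    have n: "9 * k + 1 < n" "n \<le> 9 * k + 10"
      using elim unfolding k_def by linarith+
    have "{T. nine.minimal_admissible T} \<noteq> {}"
      using card_minimal_admissible by (metis card.empty not_numeral_le_zero)
    then obtain T where "nine.minimal_admissible T" by blast
    then have "card {T. nine.minimal_admissible T} ^ k \<le> max_minimal_cds n"
      using nine.max_minimal_cds_ge[OF n(1)] by blast
    then have "40 ^ k \<le> max_minimal_cds n"
      using power_mono[OF card_minimal_admissible, of k] by linarith
    then have ge: "(40 :: real) ^ k \<le> real (max_minimal_cds n)"
      by (metis of_nat_le_iff of_nat_numeral of_nat_power)
    have "(1.489 :: real) ^ n \<le> 1.489 ^ (9 * k + 10)"
      using n(2) by (intro power_increasing) auto
    also have "\<dots> = (1.489 ^ 9) ^ k * 1.489 ^ 10"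
      by (simp only: power_add power_mult)
    \<comment> \<open>Numerically, \<open>1.489 ^ 9\<close> is just under \<open>36\<close>, hence
      below \<open>40\<close>.\<close>
    also have "\<dots> \<le> 40 ^ k * 1.489 ^ 10"
      by (intro mult_right_mono power_mono) (simp_all add: power_divide)
    also have "\<dots> \<le> real (max_minimal_cds n) * 1.489 ^ 10"
      using ge by (rule mult_right_mono) simp
    finally have "(1.489 :: real) ^ n / 1.489 ^ 10 \<le> real (max_minimal_cds n)"
      by (subst pos_divide_le_eq) simp_all
    then show ?case by simp
  qed
qed

end
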